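(* Let $r>0$ and $\Psi>0$. The volume of a bounded fibre-like circular cylinder $\mathcal{C}(r,\Psi)$ with radius $r$ and height (or altitude) $\Psi$ in the projective model of $\widetilde{\mathbf{SL}_2\mathbf{R}}$ geometry is $$\mathrm{Vol}(\mathcal{C}(r,\Psi))=\Psi\cdot\pi\cdot\sinh^2(r).$$
   Context: In hyperboloid coordinates $(r,\theta,\phi)$, related to the projective coordinates of the model by $x^0=\cosh r\cos\phi$, $x^1=\cosh r\sin\phi$, $x^2=\sinh r\cos(\theta-\phi)$, $x^3=\sinh r\sin(\theta-\phi)$ (with $\phi$ extended to $\mathbf{R}$ to pass to the universal cover), the Riemannian metric of $\widetilde{\mathbf{SL}_2\mathbf{R}}$ is $$(\mathrm{d}s)^2=(\mathrm{d}r)^2+\cosh^2 r\,\sinh^2 r\,(\mathrm{d}\theta)^2+\bigl[\mathrm{d}\phi+\sinh^2 r\,\mathrm{d}\theta\bigr]^2.$$ Volume is the Riemannian volume of this metric, with volume element $\frac12\sinh(2r)\,\mathrm{d}r\,\mathrm{d}\theta\,\mathrm{d}\phi$. The distance between two points is the arc length of the geodesic curve from one to the other. The origin is the point $r=0$, $\phi=0$, and the base plane is $\phi=0$. The fibre line through a point $(r,\theta,0)$ is $\{(r,\theta,\phi):\phi\in\mathbf{R}\}$, and the fibre translations are the maps $(r,\theta,\phi)\mapsto(r,\theta,\phi+\tau)$, $\tau\in\mathbf{R}$. The infinite circular cylinder $\mathcal{C}^i(r)$ is the solid bounded by the surface formed by the fibre lines through the points of the circle $\mathcal{C}^b(r)$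 of radius $r$ (geodesic distance) centred at the origin in the base plane; its base figure, the region of the base plane bounded by this circle, is also denoted $\mathcal{C}^b(r)$. A bounded fibre-like circular cylinder of radius $r$ is an isometric image of a solid bounded by the side surface of $\mathcal{C}^i(r)$, the base figure $\mathcal{C}^b(r)$ and the translated copy $\mathcal{C}^c(r)$ of $\mathcal{C}^b(r)$ by a fibre translation. The faces $\mathcal{C}^b(r)$ and $\mathcal{C}^c(r)$ are called cover faces. The height (or altitude) of the cylinder is the distance between its cover faces.
   Formalization: The height is taken as the length of the fibre segments joining corresponding points of the two cover faces, not as the least distance between the faces: helical curves join the faces by a shorter path, so with the least distance the formula would fail for every r and Ψ. *)

theory Defs
  imports "HOL-Analysis.Analysis"
begin

section \<open>The Riemannian manifold\<close>

text \<open>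
  Hyperboloid coordinates \<open>(r, \<theta>, \<phi>)\<close> are singular at \<open>r = 0\<close>, so points are represented by the
  global chart \<open>(sinh r cos \<theta>, sinh r sin \<theta>, \<phi>)\<close>, which identifies the universal cover with
  all of \<open>real^3\<close>. For a point \<open>p\<close> of the chart, the projective coordinates are
  \<open>x\<^sup>0 + \<i> x\<^sup>1 = sqrt (1 + p\<^sub>1\<^sup>2 + p\<^sub>2\<^sup>2) e\<^bsup>\<i> \<phi>\<^esup>\<close> and \<open>x\<^sup>2 + \<i> x\<^sup>3 = (p\<^sub>1 + \<i> p\<^sub>2) e\<^bsup>-\<i> \<phi>\<^esup>\<close>, where \<open>\<phi> = p\<^sub>3\<close>.
\<close>

definition hyperboloid :: "real \<Rightarrow> real \<Rightarrow> real \<Rightarrow> real^3" where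
  "hyperboloid r \<theta> \<phi> = vector [sinh r * cos \<theta>, sinh r * sin \<theta>, \<phi>]"

text \<open>
  The metric tensor in the chart. It is the metric
  \<open>dr\<^sup>2 + cosh\<^sup>2 r sinh\<^sup>2 r d\<theta>\<^sup>2 + (d\<phi> + sinh\<^sup>2 r d\<theta>)\<^sup>2\<close>,
  as shown by \<open>slr_metric_hyperboloid\<close> below; note that \<open>sinh\<^sup>2 r d\<theta>\<close> is \<open>p\<^sub>1 dp\<^sub>2 - p\<^sub>2 dp\<^sub>1\<close>.
\<close>

definition slr_metric :: "real^3 \<Rightarrow> real^3 \<Rightarrow> real^3 \<Rightarrow> real" where
  "slr_metric p v w =
     (v$1 * w$1 + v$2 * w$2)
     - (p$1 * v$1 + p$2 * v$2) * (p$1 * w$1 + p$2 * w$2) / (1 + (p$1)\<^sup>2 + (p$2)\<^sup>2)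
     + (p$1 * v$2 - p$2 * v$1) * (p$1 * w$2 - p$2 * w$1)
     + (v$3 + (p$1 * v$2 - p$2 * v$1)) * (w$3 + (p$1 * w$2 - p$2 * w$1))"

lemma has_vector_derivative_vec3:
  assumes "(x has_real_derivative x') (at t)" "(y has_real_derivative y') (at t)"
    and "(z has_real_derivative z') (at t)"
  shows "((\<lambda>t. vector [x t, y t, z t] :: real^3) has_vector_derivative vector [x', y', z']) (at t)"
proof -
  have expand: "(vector [a, b, c] :: real^3) = a *\<^sub>R axis 1 1 + b *\<^sub>R axis 2 1 + c *\<^sub>R axis 3 1"
    for a b c :: real
    by (simp add: vec_eq_iff forall_3 axis_def)
  show ?thesis
    unfolding expand using assms
    by (auto intro!: derivative_eq_intros simp: has_real_derivative_iff_has_vector_derivative)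
qed

lemma slr_metric_hyperboloid:
  assumes "(r has_real_derivative r') (at t)" "(\<theta> has_real_derivative \<theta>') (at t)"
    and "(\<phi> has_real_derivative \<phi>') (at t)"
  obtains v where
    "((\<lambda>t. hyperboloid (r t) (\<theta> t) (\<phi> t)) has_vector_derivative v) (at t)"
    "slr_metric (hyperboloid (r t) (\<theta> t) (\<phi> t)) v v =
       r'\<^sup>2 + (cosh (r t))\<^sup>2 * (sinh (r t))\<^sup>2 * \<theta>'\<^sup>2 + (\<phi>' + (sinh (r t))\<^sup>2 * \<theta>')\<^sup>2"
proof
  define a b where "a = cosh (r t) * r' * cos (\<theta> t) - sinh (r t) * (sin (\<theta> t) * \<theta>')"
    and "b = cosh (r t) * r' * sin (\<theta> t) + sinh (r t) * (cos (\<theta> t) * \<theta>')"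
  show "((\<lambda>t. hyperboloid (r t) (\<theta> t) (\<phi> t)) has_vector_derivative vector [a, b, \<phi>']) (at t)"
    unfolding hyperboloid_def a_def b_def using assms
    by (intro has_vector_derivative_vec3) (auto intro!: derivative_eq_intros)
  define S C s c where "S = sinh (r t)" and "C = cosh (r t)" and "s = sin (\<theta> t)" and "c = cos (\<theta> t)"
  have ab: "a = C * r' * c - S * (s * \<theta>')" "b = C * r' * s + S * (c * \<theta>')"
    by (simp_all add: a_def b_def S_def C_def s_def c_def)
  have sc: "s\<^sup>2 = 1 - c\<^sup>2" by (simp add: s_def c_def sin_squared_eq)
  have SC: "C\<^sup>2 = 1 + S\<^sup>2" by (simp add: S_def C_def cosh_square_eq)
  have e1: "S * c * a + S * s * b = S * C * r'"
  proof -
    have "S * c * a + S * s * b = S * C * r' * (c\<^sup>2 + s\<^sup>2)"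
      by (simp add: ab algebra_simps power2_eq_square)
    then show ?thesis using sc by simp
  qed
  have e2: "S * c * b - S * s * a = S\<^sup>2 * \<theta>'"
  proof -
    have "S * c * b - S * s * a = S\<^sup>2 * \<theta>' * (c\<^sup>2 + s\<^sup>2)"
      by (simp add: ab algebra_simps power2_eq_square)
    then show ?thesis using sc by simp
  qed
  have e3: "a * a + b * b = C\<^sup>2 * r'\<^sup>2 + S\<^sup>2 * \<theta>'\<^sup>2"
  proof -
    have "a * a + b * b = (C\<^sup>2 * r'\<^sup>2 + S\<^sup>2 * \<theta>'\<^sup>2) * (c\<^sup>2 + s\<^sup>2)"
      by (simp add: ab algebra_simps power2_eq_square)
    then show ?thesis using sc by simp
  qed
  have e4: "1 + (S * c)\<^sup>2 + (S * s)\<^sup>2 = C\<^sup>2"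
    unfolding power_mult_distrib SC sc by (simp add: algebra_simps)
  have nz: "C \<noteq> 0" by (simp add: C_def)
  have e5: "(S * C * r') * (S * C * r') / C\<^sup>2 = S\<^sup>2 * r'\<^sup>2"
    using nz by (simp add: power2_eq_square)
  have "slr_metric (vector [S * c, S * s, \<phi> t]) (vector [a, b, \<phi>']) (vector [a, b, \<phi>']) =
     C\<^sup>2 * r'\<^sup>2 + S\<^sup>2 * \<theta>'\<^sup>2 - S\<^sup>2 * r'\<^sup>2 + (S\<^sup>2 * \<theta>') * (S\<^sup>2 * \<theta>') + (\<phi>' + S\<^sup>2 * \<theta>')\<^sup>2"
    unfolding slr_metric_def vector_3 e1 e2 e3 e4 e5 by (simp add: power2_eq_square)
  also have "\<dots> = r'\<^sup>2 + C\<^sup>2 * S\<^sup>2 * \<theta>'\<^sup>2 + (\<phi>' + S\<^sup>2 * \<theta>')\<^sup>2"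
    unfolding SC by (simp add: algebra_simps power2_eq_square)
  finally show "slr_metric (hyperboloid (r t) (\<theta> t) (\<phi> t)) (vector [a, b, \<phi>']) (vector [a, b, \<phi>']) =
       r'\<^sup>2 + (cosh (r t))\<^sup>2 * (sinh (r t))\<^sup>2 * \<theta>'\<^sup>2 + (\<phi>' + (sinh (r t))\<^sup>2 * \<theta>')\<^sup>2"
    by (simp add: hyperboloid_def S_def C_def s_def c_def)
qed

definition arc_length :: "(real \<Rightarrow> real^3) \<Rightarrow> real" where
  "arc_length \<gamma> = integral {0..1} (\<lambda>t. sqrt (slr_metric (\<gamma> t)
     (vector_derivative \<gamma> (at t)) (vector_derivative \<gamma> (at t))))"

text \<open>
  The infimum is taken over curves that are continuously differentiable on the whole of \<open>[0,1]\<close>.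
  With \<open>piecewise_C1_differentiable_on\<close> the derivative may be unbounded near a corner; the speed
  could then fail to be integrable and such a curve would get \<open>arc_length\<close> zero.
\<close>

definition slr_dist :: "real^3 \<Rightarrow> real^3 \<Rightarrow> real" where
  "slr_dist p q = Inf {arc_length \<gamma> |\<gamma>. \<gamma> C1_differentiable_on {0..1} \<and> pathstart \<gamma> = p \<and> pathfinish \<gamma> = q}"

text \<open>
  Affinely parametrized, not necessarily minimizing geodesics: solutions of the Euler--Lagrange
  equations of the energy, \<open>d/dt g\<^sub>\<gamma>(\<gamma>', v) = 1/2 (\<partial>\<^sub>v g)\<^sub>\<gamma>(\<gamma>', \<gamma>')\<close> for each coordinate vector \<open>v\<close>.
\<close>

definition slr_geodesic :: "(real \<Rightarrow> real^3) \<Rightarrow> bool" where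
  "slr_geodesic \<gamma> \<longleftrightarrow> \<gamma> C1_differentiable_on {0..1} \<and>
     (\<forall>t\<in>{0..1}. \<forall>v.
        ((\<lambda>s. slr_metric (\<gamma> s) (vector_derivative \<gamma> (at s)) v) has_real_derivative
           1/2 * frechet_derivative
             (\<lambda>q. slr_metric q (vector_derivative \<gamma> (at t)) (vector_derivative \<gamma> (at t))) (at (\<gamma> t)) v)
        (at t within {0..1}))"

definition slr_volume :: "(real^3) set \<Rightarrow> real" where
  "slr_volume S = measure (density lebesgue
     (\<lambda>p. ennreal (sqrt (det (\<chi> i j. slr_metric p (axis i 1) (axis j 1))))) ) S"

text \<open>
  The Gram determinant is 1. Since \<open>dp\<^sub>1 dp\<^sub>2 dp\<^sub>3 = sinh r cosh r dr d\<theta> d\<phi>\<close>, this is the volume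
  element \<open>1/2 sinh (2 r) dr d\<theta> d\<phi>\<close>.
\<close>

lemma slr_metric_det: "det (\<chi> i j. slr_metric p (axis i 1) (axis j 1) :: real^3^3) = 1"
proof -
  define x y where "x = p$1" and "y = p$2"
  define D where "D = 1 + x\<^sup>2 + y\<^sup>2"
  have D: "D \<noteq> 0" by (metis D_def add_pos_nonneg less_irrefl zero_le_power2 zero_less_one)
  define a b c where "a = 1 - x * x / D" and "b = 1 - y * y / D" and "c = - (x * y) / D"
  have det: "a * b - c * c = 1 / D"
    unfolding a_def b_def c_def using D
    by (simp add: field_simps power2_eq_square) (simp add: D_def algebra_simps power2_eq_square)
  have adj: "a * x * x + b * y * y + 2 * c * x * y = (x\<^sup>2 + y\<^sup>2) / D"
    unfolding a_def b_def c_def using D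
    by (simp add: field_simps power2_eq_square) (simp add: D_def algebra_simps power2_eq_square)
  have metric: "slr_metric p v w = v$1 * w$1 + v$2 * w$2
      - (x * v$1 + y * v$2) * (x * w$1 + y * w$2) / D
      + (x * v$2 - y * v$1) * (x * w$2 - y * w$1)
      + (v$3 + (x * v$2 - y * v$1)) * (w$3 + (x * w$2 - y * w$1))" for v w
    by (simp add: slr_metric_def x_def y_def D_def)
  have "det (\<chi> i j. slr_metric p (axis i 1) (axis j 1) :: real^3^3)
      = (a * b - c * c) + (a * x * x + b * y * y + 2 * c * x * y)"
    by (simp add: det_3 metric axis_def a_def b_def c_def algebra_simps)
  also have "\<dots> = (1 + (x\<^sup>2 + y\<^sup>2)) / D" unfolding det adj by (rule add_divide_distrib[symmetric])
  also have "1 + (x\<^sup>2 + y\<^sup>2) = D" by (simp add: D_def)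
  finally show ?thesis using D by simp
qed

text \<open>
  Plain differentiability suffices here: by the Myers--Steenrod theorem such a map is smooth.
\<close>

definition slr_isometry :: "(real^3 \<Rightarrow> real^3) \<Rightarrow> bool" where
  "slr_isometry f \<longleftrightarrow> bij f \<and> f differentiable_on UNIV \<and>
     (\<forall>p v w. slr_metric (f p) (frechet_derivative f (at p) v) (frechet_derivative f (at p) w)
            = slr_metric p v w)"


section \<open>Fibre-like cylinders\<close>

definition fibre_translation :: "real \<Rightarrow> real^3 \<Rightarrow> real^3" where
  "fibre_translation \<tau> p = vector [p$1, p$2, p$3 + \<tau>]"

definition fibre_line :: "real^3 \<Rightarrow> (real^3) set" where
  "fibre_line p = range (\<lambda>\<tau>. fibre_translation \<tau> p)"

definition base_plane :: "(real^3) set" where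
  "base_plane = {p. p$3 = 0}"

definition base_circle :: "real \<Rightarrow> (real^3) set" where
  "base_circle r = {p \<in> base_plane. slr_dist 0 p = r}"

definition base_figure :: "real \<Rightarrow> (real^3) set" where
  "base_figure r = {p \<in> base_plane. slr_dist 0 p \<le> r}"

definition cylinder_surface :: "real \<Rightarrow> (real^3) set" where
  "cylinder_surface r = (\<Union>p\<in>base_circle r. fibre_line p)"

definition solid_bounded_by :: "(real^3) set \<Rightarrow> (real^3) set" where
  "solid_bounded_by S = closure (inside S)"

definition model_cylinder :: "real \<Rightarrow> real \<Rightarrow> (real^3) set" where
  "model_cylinder r \<tau> = solid_bounded_by
     (cylinder_surface r \<union> base_figure r \<union> fibre_translation \<tau> ` base_figure r)"

text \<open>
  The distance between the cover faces is measured along the fibre lines: it is the arc length of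
  the geodesic which joins a point of one face to its translate in the other face and runs in their
  common fibre line. It must not be read as the infimum of \<open>slr_dist\<close> over pairs of points of the two
  faces: fibre lines are not orthogonal to the base plane away from the origin, and helical curves
  on the side surface join the two faces with length less than \<open>\<bar>\<tau>\<bar>\<close> (see
  \<open>helix_shorter_than_fibre\<close>).
\<close>

definition cover_face_distance :: "real \<Rightarrow> real \<Rightarrow> real \<Rightarrow> bool" where
  "cover_face_distance r \<tau> h \<longleftrightarrow> (\<forall>p\<in>base_figure r. \<exists>\<gamma>. slr_geodesic \<gamma> \<and>
     path_image \<gamma> \<subseteq> fibre_line p \<and> pathstart \<gamma> = p \<and>
     pathfinish \<gamma> \<in> fibre_translation \<tau> ` base_figure r \<and> arc_length \<gamma> = h)"

definition bounded_fibre_cylinder :: "real \<Rightarrow> real \<Rightarrow> (real^3) set \<Rightarrow> bool" where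
  "bounded_fibre_cylinder r h C \<longleftrightarrow>
     (\<exists>\<tau> f. cover_face_distance r \<tau> h \<and> slr_isometry f \<and> C = f ` model_cylinder r \<tau>)"


section \<open>Fibre segments are geodesics, but do not minimize the distance of the faces\<close>

lemma cover_face_distance_abs: "cover_face_distance r \<tau> \<bar>\<tau>\<bar>"
  unfolding cover_face_distance_def
proof
  fix p assume p: "p \<in> base_figure r"
  define e :: "real^3" where "e = vector [0, 0, \<tau>]"
  define \<gamma> where "\<gamma> = (\<lambda>t. p + t *\<^sub>R e)"
  have \<gamma>_tr: "\<gamma> t = fibre_translation (t * \<tau>) p" for t
    by (simp add: \<gamma>_def e_def fibre_translation_def vec_eq_iff forall_3)
  have d: "(\<gamma> has_vector_derivative e) (at t)" for t
    unfolding \<gamma>_def by (auto intro!: derivative_eq_intros)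
  then have vd: "vector_derivative \<gamma> (at t) = e" for t
    by (rule vector_derivative_at)
  have C1: "\<gamma> C1_differentiable_on {0..1}"
    unfolding C1_differentiable_on_def using d by (intro exI[of _ "\<lambda>_. e"]) auto
  have ee: "slr_metric q e e = \<tau>\<^sup>2" for q
    by (simp add: slr_metric_def e_def power2_eq_square)
  have ev: "slr_metric (\<gamma> s) e v = \<tau> * (v$3 + (p$1 * v$2 - p$2 * v$1))" for s v
    by (simp add: slr_metric_def e_def \<gamma>_def)
  have "slr_geodesic \<gamma>"
    unfolding slr_geodesic_def vd ee ev using C1 by (auto simp: frechet_derivative_const)
  moreover have "path_image \<gamma> \<subseteq> fibre_line p"
    by (auto simp: path_image_def fibre_line_def \<gamma>_tr)
  moreover have "pathstart \<gamma> = p"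
    by (simp add: pathstart_def \<gamma>_def)
  moreover have "pathfinish \<gamma> \<in> fibre_translation \<tau> ` base_figure r"
    using p by (simp add: pathfinish_def \<gamma>_tr)
  moreover have "arc_length \<gamma> = \<bar>\<tau>\<bar>"
    unfolding arc_length_def vd ee by simp
  ultimately show "\<exists>\<gamma>. slr_geodesic \<gamma> \<and> path_image \<gamma> \<subseteq> fibre_line p \<and> pathstart \<gamma> = p \<and>
     pathfinish \<gamma> \<in> fibre_translation \<tau> ` base_figure r \<and> arc_length \<gamma> = \<bar>\<tau>\<bar>"
    by blast
qed

lemma slr_metric_nonneg: "slr_metric p v v \<ge> 0"
proof -
  define D where "D = 1 + (p$1)\<^sup>2 + (p$2)\<^sup>2"
  have D: "D > 0" by (simp add: D_def add_pos_nonneg)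
  have "D * (v$1 * v$1 + v$2 * v$2) - (p$1 * v$1 + p$2 * v$2) * (p$1 * v$1 + p$2 * v$2)
      = (v$1)\<^sup>2 + (v$2)\<^sup>2 + (p$1 * v$2 - p$2 * v$1)\<^sup>2"
    by (simp add: D_def algebra_simps power2_eq_square)
  also have "\<dots> \<ge> 0" by simp
  finally have "(p$1 * v$1 + p$2 * v$2) * (p$1 * v$1 + p$2 * v$2) / D \<le> v$1 * v$1 + v$2 * v$2"
    using D by (simp add: divide_le_eq mult.commute)
  then show ?thesis
    unfolding slr_metric_def D_def[symmetric] by (intro add_nonneg_nonneg) auto
qed

lemma arc_length_nonneg: "arc_length \<gamma> \<ge> 0"
  unfolding arc_length_def
  by (cases "(\<lambda>t. sqrt (slr_metric (\<gamma> t) (vector_derivative \<gamma> (at t)) (vector_derivative \<gamma> (at t))))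
        integrable_on {0..1}")
    (auto intro!: integral_nonneg simp: slr_metric_nonneg not_integrable_integral)

lemma hyperboloid_in_base_figure:
  assumes "r > 0"
  shows "hyperboloid r \<alpha> 0 \<in> base_figure r"
proof -
  define \<gamma> where "\<gamma> = (\<lambda>t. hyperboloid (r * t) \<alpha> 0)"
  define \<gamma>' where "\<gamma>' = (\<lambda>t. vector [r * cosh (r * t) * cos \<alpha>, r * cosh (r * t) * sin \<alpha>, 0] :: real^3)"
  have d: "(\<gamma> has_vector_derivative \<gamma>' t) (at t)" for t
    unfolding \<gamma>_def \<gamma>'_def hyperboloid_def
    by (intro has_vector_derivative_vec3) (auto intro!: derivative_eq_intros)
  have cont: "continuous_on {0..1} \<gamma>'"
    unfolding \<gamma>'_def by (intro continuous_at_imp_continuous_on ballI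
        has_vector_derivative_continuous[OF has_vector_derivative_vec3])
      (auto intro!: derivative_eq_intros)
  have C1: "\<gamma> C1_differentiable_on {0..1}"
    unfolding C1_differentiable_on_def using d cont by blast
  have speed: "slr_metric (\<gamma> t) (vector_derivative \<gamma> (at t)) (vector_derivative \<gamma> (at t)) = r\<^sup>2" for t
  proof -
    have "((\<lambda>t. r * t) has_real_derivative r) (at t)"
      "((\<lambda>t. \<alpha>) has_real_derivative 0) (at t)" "((\<lambda>t. 0) has_real_derivative 0) (at t)"
      by (auto intro!: derivative_eq_intros)
    then obtain v where v: "(\<gamma> has_vector_derivative v) (at t)"
      "slr_metric (\<gamma> t) v v = r\<^sup>2 + (cosh (r * t))\<^sup>2 * (sinh (r * t))\<^sup>2 * 0\<^sup>2 + (0 + (sinh (r * t))\<^sup>2 * 0)\<^sup>2"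
      unfolding \<gamma>_def by (rule slr_metric_hyperboloid)
    then show ?thesis
      using vector_derivative_at[OF v(1)] by simp
  qed
  have "pathstart \<gamma> = 0" "pathfinish \<gamma> = hyperboloid r \<alpha> 0"
    by (simp_all add: \<gamma>_def pathstart_def pathfinish_def hyperboloid_def vec_eq_iff forall_3)
  moreover have "arc_length \<gamma> = r"
    unfolding arc_length_def speed using assms by simp
  ultimately have "slr_dist 0 (hyperboloid r \<alpha> 0) \<le> r"
    unfolding slr_dist_def using C1
    by (intro cInf_lower bdd_belowI[of _ 0]) (use arc_length_nonneg in auto)
  then show ?thesis
    by (simp add: base_figure_def base_plane_def hyperboloid_def)
qed

lemma helix_shorter_than_fibre:
  assumes "r > 0" "\<tau> \<noteq> 0"
  obtains \<gamma> where "\<gamma> C1_differentiable_on {0..1}" "pathstart \<gamma> \<in> base_figure r"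
    "pathfinish \<gamma> \<in> fibre_translation \<tau> ` base_figure r" "arc_length \<gamma> < \<bar>\<tau>\<bar>"
proof -
  define S C where "S = sinh r" and "C = cosh r"
  have SC: "C\<^sup>2 = 1 + S\<^sup>2" by (simp add: S_def C_def cosh_square_eq)
  have S: "S > 0" and C: "C > 0" using assms by (auto simp: S_def C_def)
  define \<omega> where "\<omega> = - \<tau> / (C\<^sup>2 + S\<^sup>2)"
  define \<gamma> where "\<gamma> = (\<lambda>t. hyperboloid r (\<omega> * t) (\<tau> * t))"
  define \<gamma>' where "\<gamma>' = (\<lambda>t. vector [- S * \<omega> * sin (\<omega> * t), S * \<omega> * cos (\<omega> * t), \<tau>] :: real^3)"
  have d: "(\<gamma> has_vector_derivative \<gamma>' t) (at t)" for t
    unfolding \<gamma>_def \<gamma>'_def hyperboloid_def S_def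
    by (intro has_vector_derivative_vec3) (auto intro!: derivative_eq_intros)
  have cont: "continuous_on {0..1} \<gamma>'"
    unfolding \<gamma>'_def by (intro continuous_at_imp_continuous_on ballI
        has_vector_derivative_continuous[OF has_vector_derivative_vec3])
      (auto intro!: derivative_eq_intros)
  have C1: "\<gamma> C1_differentiable_on {0..1}"
    unfolding C1_differentiable_on_def using d cont by blast
  have pos: "C\<^sup>2 + S\<^sup>2 > 0" using C by (simp add: add_pos_nonneg)
  have speed: "slr_metric (\<gamma> t) (vector_derivative \<gamma> (at t)) (vector_derivative \<gamma> (at t))
      = \<tau>\<^sup>2 * (C\<^sup>2 / (C\<^sup>2 + S\<^sup>2))" for t
  proof -
    have "((\<lambda>t. r) has_real_derivative 0) (at t)"
      "((\<lambda>t. \<omega> * t) has_real_derivative \<omega>) (at t)" "((\<lambda>t. \<tau> * t) has_real_derivative \<tau>) (at t)"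
      by (auto intro!: derivative_eq_intros)
    then obtain v where v: "(\<gamma> has_vector_derivative v) (at t)"
      "slr_metric (\<gamma> t) v v = 0\<^sup>2 + C\<^sup>2 * S\<^sup>2 * \<omega>\<^sup>2 + (\<tau> + S\<^sup>2 * \<omega>)\<^sup>2"
      unfolding \<gamma>_def S_def C_def by (rule slr_metric_hyperboloid)
    have "\<tau> + S\<^sup>2 * \<omega> = \<tau> * C\<^sup>2 / (C\<^sup>2 + S\<^sup>2)"
    proof -
      have "\<tau> = \<tau> * (C\<^sup>2 + S\<^sup>2) / (C\<^sup>2 + S\<^sup>2)" using less_imp_neq[OF pos] by simp
      then have "\<tau> + S\<^sup>2 * \<omega> = \<tau> * (C\<^sup>2 + S\<^sup>2) / (C\<^sup>2 + S\<^sup>2) + S\<^sup>2 * \<omega>" by (rule arg_cong)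
      also have "\<dots> = \<tau> * C\<^sup>2 / (C\<^sup>2 + S\<^sup>2)"
        by (simp add: \<omega>_def distrib_left add_divide_distrib mult.commute)
      finally show ?thesis .
    qed
    then have "slr_metric (\<gamma> t) v v = (C\<^sup>2 * S\<^sup>2 * \<tau>\<^sup>2 + (\<tau> * C\<^sup>2)\<^sup>2) / (C\<^sup>2 + S\<^sup>2)\<^sup>2"
      unfolding v(2) by (simp add: \<omega>_def power_divide add_divide_distrib)
    also have "C\<^sup>2 * S\<^sup>2 * \<tau>\<^sup>2 + (\<tau> * C\<^sup>2)\<^sup>2 = \<tau>\<^sup>2 * C\<^sup>2 * (C\<^sup>2 + S\<^sup>2)"
      by (simp add: algebra_simps power2_eq_square)
    also have "\<dots> / (C\<^sup>2 + S\<^sup>2)\<^sup>2 = \<tau>\<^sup>2 * (C\<^sup>2 / (C\<^sup>2 + S\<^sup>2))"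
      using pos by (simp add: power2_eq_square)
    finally show ?thesis
      using vector_derivative_at[OF v(1)] by simp
  qed
  have "C\<^sup>2 / (C\<^sup>2 + S\<^sup>2) < 1" using S pos by simp
  then have "\<tau>\<^sup>2 * (C\<^sup>2 / (C\<^sup>2 + S\<^sup>2)) < \<tau>\<^sup>2 * 1"
    using assms by (intro mult_strict_left_mono) auto
  then have "sqrt (\<tau>\<^sup>2 * (C\<^sup>2 / (C\<^sup>2 + S\<^sup>2))) < \<bar>\<tau>\<bar>"
    by (metis mult.right_neutral real_sqrt_abs real_sqrt_less_iff)
  then have "arc_length \<gamma> < \<bar>\<tau>\<bar>"
    unfolding arc_length_def speed by simp
  moreover have "pathstart \<gamma> \<in> base_figure r"
    using hyperboloid_in_base_figure[OF assms(1)] by (simp add: \<gamma>_def pathstart_def)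
  moreover have "pathfinish \<gamma> = fibre_translation \<tau> (hyperboloid r \<omega> 0)"
    by (simp add: \<gamma>_def pathfinish_def fibre_translation_def hyperboloid_def)
  then have "pathfinish \<gamma> \<in> fibre_translation \<tau> ` base_figure r"
    using hyperboloid_in_base_figure[OF assms(1)] by blast
  ultimately show ?thesis using C1 that by blast
qed

end

theory Submission
  imports Defs
begin

text \<open>
  An isometry preserves Lebesgue measure because its Jacobian determinant is \<open>\<plusminus>1\<close>: the Gram
  determinant of the metric is 1 everywhere. The distance of a point of the base plane from the
  origin is found by projecting a competing curve to the vertical plane through both points: the
  coordinate \<open>arsinh (p \<bullet> u)\<close> along a horizontal unit vector \<open>u\<close> is 1-Lipschitz, and it measures the
  arc length of the radial curve in direction \<open>u\<close>. Hence the base figure is the disc of radius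
  \<open>sinh r\<close> in the chart, and the solid is a Euclidean cylinder over it. A geodesic in a fibre line
  has constant speed in the \<open>\<phi>\<close> direction, so the height is the absolute value of the translation.
\<close>

section \<open>Isometries preserve volume\<close>

text \<open>Turns the isometry condition into an identity between Gram matrices, to which
  determinants can be applied.\<close>

lemma slr_metric_matrix:
  "slr_metric p v w = v \<bullet> ((\<chi> i j. slr_metric p (axis i 1) (axis j 1)) *v w)"
  by (simp add: slr_metric_def inner_vec_def matrix_vector_mult_def sum_3 axis_def
      divide_simps) (simp add: algebra_simps)

text \<open>With \<open>A\<close> the Jacobian matrix and \<open>G\<close> the Gram matrix, the
  isometry condition reads A^T G(f p) A = G(p). Both Gram determinants are 1, so the square of
  \<open>det A\<close> is 1.\<close>

lemma slr_isometry_det: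
  assumes "slr_isometry f"
  shows "\<bar>det (matrix (frechet_derivative f (at p)))\<bar> = 1"
proof -
  define G :: "real^3 \<Rightarrow> real^3^3" where "G p = (\<chi> i j. slr_metric p (axis i 1) (axis j 1))" for p
  define A where "A = matrix (frechet_derivative f (at p))"
  have "f differentiable at p"
    using assms by (auto simp: slr_isometry_def differentiable_on_def)
  then have "linear (frechet_derivative f (at p))"
    by (rule linear_frechet_derivative)
  then have A: "frechet_derivative f (at p) v = A *v v" for v
    by (simp add: A_def)
  have eq: "v \<bullet> ((transpose A ** G (f p) ** A) *v w) = v \<bullet> (G p *v w)" for v w
  proof -
    have "v \<bullet> ((transpose A ** G (f p) ** A) *v w) = (A *v v) \<bullet> (G (f p) *v (A *v w))"
      by (metis dot_lmul_matrix matrix_vector_mul_assoc transpose_matrix_vector transpose_transpose)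
    also have "\<dots> = slr_metric (f p) (A *v v) (A *v w)"
      unfolding G_def by (rule slr_metric_matrix[symmetric])
    also have "\<dots> = slr_metric p v w"
      using assms by (simp add: slr_isometry_def flip: A)
    also have "\<dots> = v \<bullet> (G p *v w)"
      unfolding G_def by (rule slr_metric_matrix)
    finally show ?thesis .
  qed
  have "(transpose A ** G (f p) ** A) *v w = G p *v w" for w
    using eq by (metis vector_eq_ldot)
  then have "transpose A ** G (f p) ** A = G p"
    by (simp add: matrix_eq)
  then have "det A * det (G (f p)) * det A = det (G p)"
    by (metis det_mul det_transpose)
  then have "det A * det A = 1"
    by (simp add: G_def slr_metric_det)
  then show ?thesis
    by (metis A_def abs_mult_self_eq abs_1 abs_mult power2_eq_square power2_eq_1_iff abs_minus_cancel)
qed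

lemma slr_volume_eq_measure: "slr_volume S = measure lebesgue S"
  unfolding slr_volume_def slr_metric_det by (simp add: density_1)

text \<open>Change of variables for the injective map \<open>f\<close>, whose Jacobian factor is
  constantly 1.\<close>

lemma slr_volume_isometry:
  assumes "slr_isometry f" "S \<in> lmeasurable"
  shows "slr_volume (f ` S) = slr_volume S"
proof -
  have d: "f differentiable at x" and "bij f" for x
    using assms(1) by (auto simp: slr_isometry_def differentiable_on_def)
  have "(f has_derivative frechet_derivative f (at x)) (at x within S)" for x
    using d frechet_derivative_works has_derivative_at_withinI by blast
  moreover have "inj_on f S"
    using \<open>bij f\<close> by (meson bij_is_inj inj_on_subset subset_UNIV)
  moreover have "(\<lambda>x. \<bar>det (matrix (frechet_derivative f (at x)))\<bar>) integrable_on S"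
    unfolding slr_isometry_det[OF assms(1)] using assms(2) by (rule integrable_on_const)
  ultimately have "measure lebesgue (f ` S) = integral S (\<lambda>x. \<bar>det (matrix (frechet_derivative f (at x)))\<bar>)"
    using assms(2) by (intro measure_differentiable_image_eq) auto
  also have "\<dots> = measure lebesgue S"
    unfolding slr_isometry_det[OF assms(1)] using assms(2) by (simp add: lmeasure_integral)
  finally show ?thesis
    by (simp add: slr_volume_eq_measure)
qed

section \<open>Distance from the origin in the base plane\<close>

text \<open>Infinitesimal form of a Lipschitz bound: if x is the coordinate along the horizontal
  unit vector (c, s), the left side is the squared derivative of arsinh x in direction
  \<open>v\<close>. The proof rotates the horizontal plane so that (c, s) becomes the first
  axis.\<close>

lemma slr_metric_ge_along_direction:
  assumes "c\<^sup>2 + s\<^sup>2 = 1"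
  shows "(v$1 * c + v$2 * s)\<^sup>2 / ((p$1 * c + p$2 * s)\<^sup>2 + 1) \<le> slr_metric p v v"
proof -
  define x y where "x = p$1 * c + p$2 * s" and "y = p$2 * c - p$1 * s"
  define v1 v2 where "v1 = v$1 * c + v$2 * s" and "v2 = v$2 * c - v$1 * s"
  define D where "D = 1 + x\<^sup>2 + y\<^sup>2"
  have D: "D > 0" by (simp add: D_def add_pos_nonneg)
  have x: "x\<^sup>2 + 1 > 0" by (simp add: add_nonneg_pos)
  have cs: "a = a * (c\<^sup>2 + s\<^sup>2)" for a using assms by simp
  have p: "p$1 = x * c - y * s" "p$2 = y * c + x * s"
    unfolding x_def y_def using cs[of "p$1"] cs[of "p$2"] by (simp_all add: algebra_simps power2_eq_square)
  have v: "v$1 = v1 * c - v2 * s" "v$2 = v2 * c + v1 * s"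
    unfolding v1_def v2_def using cs[of "v$1"] cs[of "v$2"] by (simp_all add: algebra_simps power2_eq_square)
  \<comment> \<open>Rotations preserve the inner product (\<open>ip\<close>) and the planar cross
    product (\<open>cr\<close>), the only expressions in the horizontal components from which the
    metric is built.\<close>
  have ip: "(a * c - b * s) * (d * c - e * s) + (b * c + a * s) * (e * c + d * s) = a * d + b * e"
    for a b d e
  proof -
    have "(a * c - b * s) * (d * c - e * s) + (b * c + a * s) * (e * c + d * s)
      = (a * d + b * e) * (c\<^sup>2 + s\<^sup>2)" by (simp add: algebra_simps power2_eq_square)
    then show ?thesis using assms by simp
  qed
  have cr: "(a * c - b * s) * (e * c + d * s) - (b * c + a * s) * (d * c - e * s) = a * e - b * d"
    for a b d e
  proof -
    have "(a * c - b * s) * (e * c + d * s) - (b * c + a * s) * (d * c - e * s)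
      = (a * e - b * d) * (c\<^sup>2 + s\<^sup>2)" by (simp add: algebra_simps power2_eq_square)
    then show ?thesis using assms by simp
  qed
  define J where "J = x * v2 - y * v1"
  have pp: "1 + (p$1)\<^sup>2 + (p$2)\<^sup>2 = D"
    using ip[of x y x y] by (simp add: p D_def power2_eq_square add.assoc)
  have "slr_metric p v v = v1 * v1 + v2 * v2 - (x * v1 + y * v2) * (x * v1 + y * v2) / D
     + J * J + (v$3 + J) * (v$3 + J)"
    unfolding slr_metric_def pp J_def using ip[of v1 v2 v1 v2] ip[of x y v1 v2] cr[of x y v2 v1]
    by (simp add: p v)
  \<comment> \<open>Lagrange's identity: (x^2 + y^2) (v1^2 + v2^2) - (x v1 + y v2)^2 = J^2. The two
    summands left over are squares and are dropped afterwards.\<close>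
  also have "v1 * v1 + v2 * v2 - (x * v1 + y * v2) * (x * v1 + y * v2) / D = (v1\<^sup>2 + v2\<^sup>2 + J\<^sup>2) / D"
    using D by (simp add: field_simps J_def) (simp add: D_def algebra_simps power2_eq_square)
  finally have m: "(v1\<^sup>2 + v2\<^sup>2 + J\<^sup>2) / D \<le> slr_metric p v v"
    by simp
  \<comment> \<open>After clearing denominators, the two sides of the desired inequality differ by a
    perfect square.\<close>
  have "(x\<^sup>2 + 1) * (v1\<^sup>2 + v2\<^sup>2 + J\<^sup>2) - D * v1\<^sup>2 = (x * y * v1 - (1 + x\<^sup>2) * v2)\<^sup>2"
    by (simp add: D_def J_def algebra_simps power2_eq_square)
  then have "v1\<^sup>2 * D \<le> (v1\<^sup>2 + v2\<^sup>2 + J\<^sup>2) * (x\<^sup>2 + 1)"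
    by (metis diff_ge_0_iff_ge mult.commute zero_le_power2)
  then have "v1\<^sup>2 / (x\<^sup>2 + 1) \<le> (v1\<^sup>2 + v2\<^sup>2 + J\<^sup>2) / D"
    using D x by (simp add: divide_le_eq le_divide_eq)
  with m show ?thesis by (simp add: v1_def x_def)
qed

text \<open>Integrates the pointwise bound along the curve: the derivative of
  \<open>arsinh (w t)\<close> never exceeds the speed, and \<open>w\<close> vanishes at the
  start.\<close>

lemma arc_length_ge_arsinh:
  assumes "\<gamma> C1_differentiable_on {0..1}" "pathstart \<gamma> = 0" "c\<^sup>2 + s\<^sup>2 = 1"
  shows "arsinh (pathfinish \<gamma> $ 1 * c + pathfinish \<gamma> $ 2 * s) \<le> arc_length \<gamma>"
proof -
  obtain D where D: "\<And>t. t \<in> {0..1} \<Longrightarrow> (\<gamma> has_vector_derivative D t) (at t)"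
    and cont: "continuous_on {0..1} D"
    using assms(1) unfolding C1_differentiable_on_def by blast
  have vd: "vector_derivative \<gamma> (at t) = D t" if "t \<in> {0..1}" for t
    using D[OF that] by (rule vector_derivative_at)
  have cont\<gamma>: "continuous_on {0..1} \<gamma>"
    using D by (meson continuous_at_imp_continuous_on has_vector_derivative_continuous)
  define w where "w t = \<gamma> t $ 1 * c + \<gamma> t $ 2 * s" for t
  define w' where "w' t = D t $ 1 * c + D t $ 2 * s" for t
  have comp: "((\<lambda>t. \<gamma> t $ i) has_real_derivative D t $ i) (at t)" if "t \<in> {0..1}" for t i
    unfolding has_real_derivative_iff_has_vector_derivative
    using bounded_linear.has_vector_derivative[OF bounded_linear_vec_nth D[OF that]] .
  have "((\<lambda>t. arsinh (w t)) has_real_derivative w' t / sqrt ((w t)\<^sup>2 + 1)) (at t)"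
    if "t \<in> {0..1}" for t
  proof -
    have "(w has_real_derivative w' t) (at t)"
      unfolding w_def w'_def by (intro DERIV_add DERIV_cmult_right comp that)
    from DERIV_chain2[OF arsinh_real_has_field_derivative this] show ?thesis by simp
  qed
  then have "((\<lambda>t. w' t / sqrt ((w t)\<^sup>2 + 1)) has_integral arsinh (w 1) - arsinh (w 0)) {0..1}"
    by (intro fundamental_theorem_of_calculus)
      (auto simp flip: has_real_derivative_iff_has_vector_derivative intro: has_field_derivative_at_within)
  \<comment> \<open>Integrability has to be secured here, since \<open>integral\<close> is 0 for a
    function that is not integrable. It follows from continuity of the speed on the closed
    interval.\<close>
  moreover have "((\<lambda>t. sqrt (slr_metric (\<gamma> t) (D t) (D t))) has_integral arc_length \<gamma>) {0..1}"
  proof -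
    have nz: "1 + (\<gamma> t $ 1)\<^sup>2 + (\<gamma> t $ 2)\<^sup>2 \<noteq> 0" for t
      by (metis add_pos_nonneg less_irrefl zero_le_power2 zero_less_one)
    have "continuous_on {0..1} (\<lambda>t. sqrt (slr_metric (\<gamma> t) (D t) (D t)))"
      unfolding slr_metric_def using nz by (intro continuous_intros cont cont\<gamma>) auto
    then have "(\<lambda>t. sqrt (slr_metric (\<gamma> t) (D t) (D t))) integrable_on {0..1}"
      by (rule integrable_continuous_real)
    moreover have "arc_length \<gamma> = integral {0..1} (\<lambda>t. sqrt (slr_metric (\<gamma> t) (D t) (D t)))"
      unfolding arc_length_def by (intro integral_cong) (simp add: vd)
    ultimately show ?thesis by (simp add: has_integral_integral)
  qed
  moreover have "w' t / sqrt ((w t)\<^sup>2 + 1) \<le> sqrt (slr_metric (\<gamma> t) (D t) (D t))" for t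
    using slr_metric_ge_along_direction[OF assms(3), of "D t" "\<gamma> t"]
    by (intro real_le_rsqrt) (simp add: w_def w'_def power_divide add_nonneg_nonneg)
  ultimately have "arsinh (w 1) - arsinh (w 0) \<le> arc_length \<gamma>"
    by (meson has_integral_le)
  moreover have "w 0 = 0" "w 1 = pathfinish \<gamma> $ 1 * c + pathfinish \<gamma> $ 2 * s"
    using assms(2) by (simp_all add: w_def pathstart_def pathfinish_def)
  ultimately show ?thesis by simp
qed

lemma slr_dist_le_arc_length:
  assumes "\<gamma> C1_differentiable_on {0..1}"
  shows "slr_dist (pathstart \<gamma>) (pathfinish \<gamma>) \<le> arc_length \<gamma>"
  unfolding slr_dist_def using assms
  by (intro cInf_lower bdd_belowI[of _ 0]) (use arc_length_nonneg in auto)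

text \<open>The radial curve gives the upper bound, and \<open>arc_length_ge_arsinh\<close> in the
  direction of \<open>p\<close> gives the matching lower bound for every competing curve.\<close>

lemma slr_dist_base_plane:
  assumes "p \<in> base_plane"
  shows "slr_dist 0 p = arsinh (sqrt ((p$1)\<^sup>2 + (p$2)\<^sup>2))"
proof -
  define \<rho> where "\<rho> = sqrt ((p$1)\<^sup>2 + (p$2)\<^sup>2)"
  obtain c s where cs: "c\<^sup>2 + s\<^sup>2 = 1" "p$1 = \<rho> * c" "p$2 = \<rho> * s"
  proof (cases "\<rho> = 0")
    case True
    then have "p$1 = 0 \<and> p$2 = 0" by (simp add: \<rho>_def sum_power2_eq_zero_iff)
    with True that[of 1 0] show ?thesis by simp
  next
    case False
    have "(p$1 / \<rho>)\<^sup>2 + (p$2 / \<rho>)\<^sup>2 = ((p$1)\<^sup>2 + (p$2)\<^sup>2) / \<rho>\<^sup>2"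
      by (simp add: power_divide add_divide_distrib)
    also have "(p$1)\<^sup>2 + (p$2)\<^sup>2 = \<rho>\<^sup>2" by (simp add: \<rho>_def)
    finally show ?thesis
      using False by (intro that[of "p$1 / \<rho>" "p$2 / \<rho>"]) simp_all
  qed
  obtain \<alpha> where \<alpha>: "c = cos \<alpha>" "s = sin \<alpha>"
    using sincos_total_2pi cs(1) by metis
  have "\<rho> \<ge> 0" by (simp add: \<rho>_def)
  have p: "p = hyperboloid (arsinh \<rho>) \<alpha> 0"
    using assms cs(2,3) by (simp add: hyperboloid_def vec_eq_iff forall_3 base_plane_def \<alpha>)
  have "slr_dist 0 p \<le> arsinh \<rho>"
  proof (cases "\<rho> = 0")
    case True
    \<comment> \<open>The radial curve is available for positive radius only; at the origin a
      constant curve of length 0 takes its place.\<close>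
    have "slr_dist (pathstart (\<lambda>_. 0)) (pathfinish (\<lambda>_. 0)) \<le> arc_length (\<lambda>_. 0)"
      by (intro slr_dist_le_arc_length) simp
    moreover have "p = 0"
      using True p by (simp add: hyperboloid_def vec_eq_iff forall_3)
    ultimately show ?thesis
      using True by (simp add: pathstart_def pathfinish_def arc_length_def slr_metric_def)
  next
    case False
    with \<open>\<rho> \<ge> 0\<close> have "arsinh \<rho> > 0" by simp
    then show ?thesis
      using hyperboloid_in_base_figure[of "arsinh \<rho>" \<alpha>] p by (simp add: base_figure_def)
  qed
  moreover have "arsinh \<rho> \<le> slr_dist 0 p"
    unfolding slr_dist_def
  proof (rule cInf_greatest)
    \<comment> \<open>The straight segment shows that competing curves exist, as a lower bound for
      \<open>Inf\<close> requires a nonempty set.\<close>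
    define \<gamma> where "\<gamma> = (\<lambda>t. t *\<^sub>R p)"
    have "\<gamma> C1_differentiable_on {0..1}" "pathstart \<gamma> = 0" "pathfinish \<gamma> = p"
      by (auto simp: \<gamma>_def pathstart_def pathfinish_def intro!: derivative_intros)
    then show "{arc_length \<gamma> |\<gamma>. \<gamma> C1_differentiable_on {0..1} \<and> pathstart \<gamma> = 0 \<and> pathfinish \<gamma> = p} \<noteq> {}"
      by blast
  next
    fix L assume "L \<in> {arc_length \<gamma> |\<gamma>. \<gamma> C1_differentiable_on {0..1} \<and> pathstart \<gamma> = 0 \<and> pathfinish \<gamma> = p}"
    then obtain \<gamma> where \<gamma>: "L = arc_length \<gamma>" "\<gamma> C1_differentiable_on {0..1}" "pathstart \<gamma> = 0"
      "pathfinish \<gamma> = p" by blast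
    have "p$1 * c + p$2 * s = \<rho> * (c\<^sup>2 + s\<^sup>2)"
      by (simp add: cs(2,3) algebra_simps power2_eq_square)
    then show "arsinh \<rho> \<le> L"
      using arc_length_ge_arsinh[OF \<gamma>(2,3) cs(1)] cs(1) by (simp add: \<gamma>)
  qed
  ultimately show ?thesis by (simp add: \<rho>_def)
qed

text \<open>\<open>arsinh\<close> is strictly increasing, and \<open>sqrt\<close> is extended to
  negative reals as an odd, strictly increasing function, so \<open>a\<close> may have any
  sign.\<close>

lemma arsinh_sqrt_le_iff: "arsinh (sqrt a) \<le> r \<longleftrightarrow> a \<le> (sinh r)\<^sup>2"
  and arsinh_sqrt_eq_iff: "arsinh (sqrt a) = r \<longleftrightarrow> a = (sinh r)\<^sup>2"
  if "r > 0" for a r :: real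
proof -
  have "sqrt ((sinh r)\<^sup>2) = sinh r" using that by simp
  then have r: "r = arsinh (sqrt ((sinh r)\<^sup>2))" by (simp add: arsinh_sinh_real)
  have inj: "arsinh u = arsinh v \<longleftrightarrow> u = v" for u v :: real
    by (metis sinh_arsinh_real)
  show "arsinh (sqrt a) \<le> r \<longleftrightarrow> a \<le> (sinh r)\<^sup>2"
    by (subst (1) r) (metis arsinh_less_iff_real not_le real_sqrt_less_iff)
  show "arsinh (sqrt a) = r \<longleftrightarrow> a = (sinh r)\<^sup>2"
    by (subst (1) r) (simp only: inj real_sqrt_eq_iff)
qed

lemma base_figure_eq:
  assumes "r > 0"
  shows "base_figure r = {p. (p$1)\<^sup>2 + (p$2)\<^sup>2 \<le> (sinh r)\<^sup>2 \<and> p$3 = 0}"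
  using slr_dist_base_plane arsinh_sqrt_le_iff[OF assms]
  by (auto simp: base_figure_def base_plane_def simp del: real_sqrt_abs)

lemma base_circle_eq:
  assumes "r > 0"
  shows "base_circle r = {p. (p$1)\<^sup>2 + (p$2)\<^sup>2 = (sinh r)\<^sup>2 \<and> p$3 = 0}"
  using slr_dist_base_plane arsinh_sqrt_eq_iff[OF assms]
  by (auto simp: base_circle_def base_plane_def simp del: real_sqrt_abs)

section \<open>The height determines the length of the translation\<close>

text \<open>It suffices to test the condition at the origin, whose fibre is the third axis. The
  Euler-Lagrange equation for the third coordinate makes the velocity constant, so the length is the
  absolute value of the displacement.\<close>

lemma cover_face_distance_imp_abs:
  assumes "r > 0" "cover_face_distance r \<tau> h"
  shows "h = \<bar>\<tau>\<bar>"
proof -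
  have "0 \<in> base_figure r" by (simp add: base_figure_eq assms(1))
  then obtain \<gamma> where geo: "slr_geodesic \<gamma>" and line: "path_image \<gamma> \<subseteq> fibre_line 0"
    and start: "pathstart \<gamma> = 0" and finish: "pathfinish \<gamma> \<in> fibre_translation \<tau> ` base_figure r"
    and len: "arc_length \<gamma> = h"
    using assms(2) unfolding cover_face_distance_def by blast
  have z: "\<gamma> t $ 1 = 0" "\<gamma> t $ 2 = 0" if "t \<in> {0..1}" for t
    using subsetD[OF line, of "\<gamma> t"] that
    by (auto simp: path_image_def fibre_line_def fibre_translation_def)
  have "\<gamma> C1_differentiable_on {0..1}"
    using geo by (simp add: slr_geodesic_def)
  then obtain D where D: "\<And>t. t \<in> {0..1} \<Longrightarrow> (\<gamma> has_vector_derivative D t) (at t)"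
    unfolding C1_differentiable_on_def by blast
  have vd: "vector_derivative \<gamma> (at t) = D t" if "t \<in> {0..1}" for t
    using D[OF that] by (rule vector_derivative_at)
  have comp: "((\<lambda>t. \<gamma> t $ i) has_vector_derivative D t $ i) (at t within {0..1})" if "t \<in> {0..1}" for t i
    using bounded_linear.has_vector_derivative[OF bounded_linear_vec_nth D[OF that]]
    by (rule has_vector_derivative_at_within)
  have D12: "D t $ i = 0" if t: "t \<in> {0..1}" and i: "i = 1 \<or> i = 2" for t i
  proof -
    \<comment> \<open>The curve is known to stay on the axis only for parameters in [0,1], so
      derivatives are compared within this interval, where they are unique even at the
      endpoints.\<close>
    have "((\<lambda>t. 0) has_vector_derivative D t $ i) (at t within {0..1})"
      by (rule has_vector_derivative_transform[OF t _ comp[OF t]]) (use z i in auto)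
    then show ?thesis
      using vector_derivative_unique_within_closed_interval[of 0 1 t "\<lambda>t. 0::real"] t by fastforce
  qed
  have metric_vert: "slr_metric q (D t) (D t) = (D t $ 3)\<^sup>2" if "t \<in> {0..1}" for q t
    using D12[OF that] by (simp add: slr_metric_def power2_eq_square)
  have "((\<lambda>s. D s $ 3) has_real_derivative 0) (at t within {0..1})" if t: "t \<in> {0..1}" for t
  proof -
    have "((\<lambda>s. slr_metric (\<gamma> s) (vector_derivative \<gamma> (at s)) (axis 3 1)) has_real_derivative
           1/2 * frechet_derivative
             (\<lambda>q. slr_metric q (vector_derivative \<gamma> (at t)) (vector_derivative \<gamma> (at t))) (at (\<gamma> t)) (axis 3 1))
        (at t within {0..1})"
      using geo t unfolding slr_geodesic_def by blast
    \<comment> \<open>The length of a vertical vector is the same at every base point, hence the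
      right side of the geodesic equation is the derivative of a constant.\<close>
    moreover have "(\<lambda>q. slr_metric q (vector_derivative \<gamma> (at t)) (vector_derivative \<gamma> (at t)))
        = (\<lambda>q. (D t $ 3)\<^sup>2)"
      using t by (simp add: vd metric_vert)
    ultimately have *: "((\<lambda>s. slr_metric (\<gamma> s) (vector_derivative \<gamma> (at s)) (axis 3 1)) has_real_derivative 0)
        (at t within {0..1})"
      by (simp add: frechet_derivative_const)
    show ?thesis
      by (rule has_field_derivative_transform_within[OF * zero_less_one t])
        (simp add: vd z slr_metric_def axis_def)
  qed
  then obtain k where k: "\<And>t. t \<in> {0..1} \<Longrightarrow> D t $ 3 = k"
    using has_field_derivative_zero_constant[of "{0..1}" "\<lambda>s. D s $ 3"] by auto
  have int: "((\<lambda>t. D t $ 3) has_integral \<gamma> 1 $ 3 - \<gamma> 0 $ 3) {0..1}"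
    using comp by (intro fundamental_theorem_of_calculus) auto
  have "((\<lambda>t::real. k) has_integral \<gamma> 1 $ 3 - \<gamma> 0 $ 3) {0..1}"
    by (rule has_integral_eq[OF _ int]) (simp add: k)
  then have "\<gamma> 1 $ 3 - \<gamma> 0 $ 3 = k"
    using has_integral_unique[OF _ has_integral_const_real[of k 0 1]] by simp
  moreover have "\<gamma> 0 $ 3 = 0" "\<gamma> 1 $ 3 = \<tau>"
    using start finish assms(1)
    by (auto simp: pathstart_def pathfinish_def fibre_translation_def base_figure_eq)
  moreover have "arc_length \<gamma> = integral {0..1} (\<lambda>t::real. \<bar>k\<bar>)"
    unfolding arc_length_def by (intro integral_cong) (simp add: vd metric_vert k)
  ultimately show ?thesis using len by simp
qed

section \<open>Volume of a Euclidean cylinder\<close>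

text \<open>Passing to \<open>complex \<times> real\<close> makes a cylinder a product of a disc and
  an interval, so that product measure and the area of a disc apply.\<close>

definition of_cylinder :: "complex \<times> real \<Rightarrow> real^3" where
  "of_cylinder w = vector [Re (fst w), Im (fst w), snd w]"

lemma of_cylinder_nth [simp]:
  "of_cylinder w $ 1 = Re (fst w)" "of_cylinder w $ 2 = Im (fst w)" "of_cylinder w $ 3 = snd w"
  by (simp_all add: of_cylinder_def)

lemma linear_of_cylinder: "linear of_cylinder"
  by (intro linearI) (simp_all add: vec_eq_iff forall_3)

lemma borel_measurable_of_cylinder: "of_cylinder \<in> borel_measurable borel"
  by (intro borel_measurable_continuous_onI linear_continuous_on
      linear_conv_bounded_linear[THEN iffD1] linear_of_cylinder)

lemma of_cylinder_inverse: "of_cylinder (Complex (p$1) (p$2), p$3) = p"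
  by (simp add: vec_eq_iff forall_3)

lemma inj_of_cylinder: "inj of_cylinder"
  by (intro injI) (simp add: vec_eq_iff forall_3 prod_eq_iff complex_eq_iff)

lemma of_cylinder_image: "of_cylinder ` A = {p. (Complex (p$1) (p$2), p$3) \<in> A}"
proof (intro set_eqI iffI)
  fix p :: "real^3" assume "p \<in> {p. (Complex (p$1) (p$2), p$3) \<in> A}"
  then show "p \<in> of_cylinder ` A"
    using of_cylinder_inverse[of p] by force
qed auto

text \<open>The map only regroups coordinates, so preimages of boxes are boxes with the same side
  lengths, and values on boxes determine Lebesgue measure.\<close>

lemma lborel_distr_of_cylinder: "distr lborel borel of_cylinder = lborel"
proof (rule lborel_eqI[symmetric])
  fix l u :: "real^3" assume le: "\<And>b. b \<in> Basis \<Longrightarrow> l \<bullet> b \<le> u \<bullet> b"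
  have le': "l $ i \<le> u $ i" for i
    using le[of "axis i 1"] by (simp add: axis_in_Basis_iff inner_axis)
  have "of_cylinder -` box l u = box (Complex (l$1) (l$2), l$3) (Complex (u$1) (u$2), u$3)"
    by (auto simp: mem_box_cart forall_3 mem_box Basis_prod_def Basis_complex_def)
  then have "emeasure (distr lborel borel of_cylinder) (box l u)
      = emeasure lborel (box (Complex (l$1) (l$2), l$3) (Complex (u$1) (u$2), u$3))"
    by (simp add: emeasure_distr borel_measurable_of_cylinder)
  also have "\<dots> = ennreal ((u$1 - l$1) * (u$2 - l$2) * (u$3 - l$3))"
    using le' by (subst emeasure_lborel_box)
      (auto simp: Basis_prod_def Basis_complex_def prod.union_disjoint prod.reindex inj_on_def)
  also have "\<dots> = (\<Prod>b\<in>Basis. (u - l) \<bullet> b)"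
  proof -
    have Basis: "(Basis :: (real^3) set) = {axis 1 1, axis 2 1, axis 3 1}"
      by (auto simp: Basis_vec_def UNIV_3)
    show ?thesis
      unfolding Basis by (simp add: axis_eq_axis inner_axis mult.assoc)
  qed
  finally show "emeasure (distr lborel borel of_cylinder) (box l u) = (\<Prod>b\<in>Basis. (u - l) \<bullet> b)" .
qed simp

lemma measure_of_cylinder_image:
  assumes "A \<in> sets borel"
  shows "measure lborel (of_cylinder ` A) = measure lborel A"
proof -
  \<comment> \<open>The image is Borel because it is the preimage of \<open>A\<close> under the
    continuous inverse map.\<close>
  have "(\<lambda>p::real^3. (Complex (p$1) (p$2), p$3)) \<in> borel_measurable borel"
    by (intro borel_measurable_continuous_onI continuous_intros)
  then have "of_cylinder ` A \<in> sets borel"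
    using measurable_sets[OF _ assms, of _ borel] by (simp add: of_cylinder_image vimage_def)
  then show ?thesis
    by (subst lborel_distr_of_cylinder[symmetric])
      (simp add: measure_distr borel_measurable_of_cylinder inj_vimage_image_eq[OF inj_of_cylinder])
qed

lemma measure_cylinder:
  assumes "R \<ge> 0" "a \<le> b"
  shows "measure lborel (of_cylinder ` (cball 0 R \<times> {a..b})) = pi * R\<^sup>2 * (b - a)"
proof -
  have "measure lborel (cball (0::complex) R \<times> {a..b}) = measure (lborel \<Otimes>\<^sub>M lborel) (cball (0::complex) R \<times> {a..b})"
    by (simp add: lborel_prod)
  also have "\<dots> = measure lborel (cball (0::complex) R) * measure lborel {a..b}"
    by (simp add: measure_def lborel.emeasure_pair_measure_Times enn2real_mult)
  also have "\<dots> = pi * R\<^sup>2 * (b - a)"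
    using assms by (simp add: content_cball unit_ball_vol_2)
  finally show ?thesis
    by (subst measure_of_cylinder_image) (auto intro!: borel_closed closed_Times)
qed

section \<open>The solid bounded by a capped cylinder\<close>

text \<open>A ray that avoids \<open>S\<close> is a connected unbounded set, so the component of its
  starting point in the complement of \<open>S\<close> is unbounded.\<close>

lemma not_in_inside_ray:
  fixes p v :: "'a::real_normed_vector"
  assumes "v \<noteq> 0" "\<And>t. t \<ge> 0 \<Longrightarrow> p + t *\<^sub>R v \<notin> S"
  shows "p \<notin> inside S"
proof
  assume "p \<in> inside S"
  define A where "A = (\<lambda>t. p + t *\<^sub>R v) ` {0..}"
  have "connected A"
    unfolding A_def by (intro connected_continuous_image continuous_intros) simp
  moreover have "p \<in> A" "A \<subseteq> - S"
    using assms(2) by (force simp: A_def)+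
  ultimately have "A \<subseteq> connected_component_set (- S) p"
    by (intro connected_component_maximal)
  with \<open>p \<in> inside S\<close> have "bounded A"
    unfolding inside_def using bounded_subset by blast
  then obtain B where B: "\<And>x. x \<in> A \<Longrightarrow> norm x \<le> B"
    unfolding bounded_iff by blast
  \<comment> \<open>Chosen so that the norm of \<open>t *\<^sub>R v\<close> exceeds
    \<open>norm p + B\<close>, against the triangle inequality.\<close>
  define t where "t = (norm p + \<bar>B\<bar> + 1) / norm v"
  have "t \<ge> 0" by (simp add: t_def)
  then have "norm (p + t *\<^sub>R v) \<le> B" by (intro B) (auto simp: A_def)
  moreover have "norm (t *\<^sub>R v) = norm p + \<bar>B\<bar> + 1"
    using \<open>v \<noteq> 0\<close> \<open>t \<ge> 0\<close> by (simp add: t_def)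
  ultimately show False
    using norm_triangle_ineq4[of "p + t *\<^sub>R v" p] by simp
qed

text \<open>A component of the complement of \<open>S\<close> that meets \<open>I\<close> cannot
  cross the frontier of \<open>I\<close>, so it stays in the bounded set \<open>I\<close>.\<close>

lemma subset_inside_if_frontier_subset:
  fixes I S :: "'a::real_normed_vector set"
  assumes "bounded I" "I \<inter> S = {}" "frontier I \<subseteq> S"
  shows "I \<subseteq> inside S"
proof
  fix p assume "p \<in> I"
  let ?C = "connected_component_set (- S) p"
  have "p \<notin> S" using \<open>p \<in> I\<close> assms(2) by blast
  then have "p \<in> ?C"
    by (simp add: connected_component_refl)
  with \<open>p \<in> I\<close> have "?C \<inter> I \<noteq> {}" by blast
  moreover have "?C \<inter> frontier I = {}"
    using assms(3) connected_component_subset[of "- S" p] by blast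
  ultimately have "?C \<subseteq> I"
    using connected_Int_frontier[of ?C I] connected_connected_component by blast
  then show "p \<in> inside S"
    unfolding inside_def using \<open>p \<notin> S\<close> assms(1) bounded_subset by blast
qed

lemma closure_open_cylinder:
  assumes "R > 0" "a < b"
  shows "closure (of_cylinder ` (ball 0 R \<times> {a<..<b})) = of_cylinder ` (cball 0 R \<times> {a..b})"
  unfolding closure_injective_linear_image[OF linear_of_cylinder inj_of_cylinder, symmetric]
  using assms by (simp add: closure_Times)

text \<open>The side surface extends infinitely beyond both caps. The open cylinder between the caps
  has its frontier in the surface; every other point off the surface escapes along a ray: radially
  outwards from outside the tube, downwards from below the lower cap, upwards from above the upper
  one.\<close>

lemma inside_capped_cylinder:
  assumes "R > 0" "a < b"
  shows "inside ({p. (p$1)\<^sup>2 + (p$2)\<^sup>2 = R\<^sup>2} \<union> {p. (p$1)\<^sup>2 + (p$2)\<^sup>2 \<le> R\<^sup>2 \<and> (p$3 = a \<or> p$3 = b)})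
    = of_cylinder ` (ball 0 R \<times> {a<..<b})"
    (is "inside ?S = of_cylinder ` ?B")
proof
  have norm_iff: "norm (Complex x y) < R \<longleftrightarrow> x\<^sup>2 + y\<^sup>2 < R\<^sup>2"
    "norm (Complex x y) \<le> R \<longleftrightarrow> x\<^sup>2 + y\<^sup>2 \<le> R\<^sup>2" for x y
    using \<open>R > 0\<close> real_sqrt_less_iff[of "x\<^sup>2 + y\<^sup>2" "R\<^sup>2"] real_sqrt_le_iff[of "x\<^sup>2 + y\<^sup>2" "R\<^sup>2"]
    by (simp_all add: complex_norm del: real_sqrt_less_iff real_sqrt_le_iff)
  have I: "of_cylinder ` ?B = {p. (p$1)\<^sup>2 + (p$2)\<^sup>2 < R\<^sup>2 \<and> a < p$3 \<and> p$3 < b}"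
    by (auto simp: of_cylinder_image norm_iff)
  show "of_cylinder ` ?B \<subseteq> inside ?S"
  proof (rule subset_inside_if_frontier_subset)
    show "bounded (of_cylinder ` ?B)"
      by (intro bounded_linear_image bounded_Times linear_conv_bounded_linear[THEN iffD1] linear_of_cylinder) auto
    show "of_cylinder ` ?B \<inter> ?S = {}"
      unfolding I by auto
    have "closure (of_cylinder ` ?B) = of_cylinder ` (cball 0 R \<times> {a..b})"
      using assms by (rule closure_open_cylinder)
    also have "\<dots> = {p. (p$1)\<^sup>2 + (p$2)\<^sup>2 \<le> R\<^sup>2 \<and> a \<le> p$3 \<and> p$3 \<le> b}"
      by (auto simp: of_cylinder_image norm_iff)
    finally have cl: "closure (of_cylinder ` ?B) = \<dots>" .
    have "open (of_cylinder ` ?B)"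
      unfolding I by (intro open_Collect_conj open_Collect_less continuous_intros)
    then have "frontier (of_cylinder ` ?B)
        = {p. (p$1)\<^sup>2 + (p$2)\<^sup>2 \<le> R\<^sup>2 \<and> a \<le> p$3 \<and> p$3 \<le> b} - of_cylinder ` ?B"
      unfolding frontier_def cl by (simp add: interior_open)
    then show "frontier (of_cylinder ` ?B) \<subseteq> ?S"
      unfolding I by auto
  qed
  show "inside ?S \<subseteq> of_cylinder ` ?B"
  proof
    fix p assume p: "p \<in> inside ?S"
    then have "p \<notin> ?S" using inside_no_overlap by blast
    show "p \<in> of_cylinder ` ?B"
    proof (rule ccontr)
      assume "p \<notin> of_cylinder ` ?B"
      with \<open>p \<notin> ?S\<close> consider "(p$1)\<^sup>2 + (p$2)\<^sup>2 > R\<^sup>2"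
        | "(p$1)\<^sup>2 + (p$2)\<^sup>2 < R\<^sup>2" "p$3 < a" | "(p$1)\<^sup>2 + (p$2)\<^sup>2 < R\<^sup>2" "p$3 > b"
        unfolding I by fastforce
      then show False
      proof cases
        case 1
        define v :: "real^3" where "v = vector [p$1, p$2, 0]"
        have "v \<noteq> 0" using 1 by (auto simp: v_def vec_eq_iff forall_3)
        moreover have "p + t *\<^sub>R v \<notin> ?S" if "t \<ge> 0" for t
        proof -
          \<comment> \<open>Moving along the ray scales the horizontal part of \<open>p\<close> by 1
            + t, so its distance from the axis never decreases.\<close>
          have "R\<^sup>2 < 1 * ((p$1)\<^sup>2 + (p$2)\<^sup>2)" using 1 by simp
          also have "\<dots> \<le> (1 + t)\<^sup>2 * ((p$1)\<^sup>2 + (p$2)\<^sup>2)"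
            using that by (intro mult_right_mono) auto
          also have "\<dots> = ((p + t *\<^sub>R v)$1)\<^sup>2 + ((p + t *\<^sub>R v)$2)\<^sup>2"
            by (simp add: v_def algebra_simps power2_eq_square)
          finally show ?thesis by auto
        qed
        ultimately show False using not_in_inside_ray p by blast
      next
        case 2
        have "p + t *\<^sub>R - axis 3 1 \<notin> ?S" if "t \<ge> 0" for t
          using 2 that assms by (auto simp: axis_def)
        moreover have "- axis 3 1 \<noteq> (0 :: real^3)" by (simp add: axis_eq_0_iff)
        ultimately show False using not_in_inside_ray p by blast
      next
        case 3
        have "p + t *\<^sub>R axis 3 1 \<notin> ?S" if "t \<ge> 0" for t
          using 3 that assms by (auto simp: axis_def)
        moreover have "axis 3 1 \<noteq> (0 :: real^3)" by (simp add: axis_eq_0_iff)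
        ultimately show False using not_in_inside_ray p by blast
      qed
    qed
  qed
qed

section \<open>The model cylinder and its volume\<close>

text \<open>The translation may go up or down, so \<open>min\<close> and \<open>max\<close> select
  the lower and the upper cap.\<close>

lemma model_cylinder_eq:
  assumes "r > 0" "\<tau> \<noteq> 0"
  shows "model_cylinder r \<tau> = of_cylinder ` (cball 0 (sinh r) \<times> {min 0 \<tau>..max 0 \<tau>})"
proof -
  have "cylinder_surface r = {p. (p$1)\<^sup>2 + (p$2)\<^sup>2 = (sinh r)\<^sup>2}"
  proof (intro set_eqI iffI)
    fix p :: "real^3" assume "p \<in> {p. (p$1)\<^sup>2 + (p$2)\<^sup>2 = (sinh r)\<^sup>2}"
    then have "vector [p$1, p$2, 0] \<in> base_circle r"
      by (simp add: base_circle_eq[OF assms(1)])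
    moreover have "p = fibre_translation (p$3) (vector [p$1, p$2, 0])"
      by (simp add: fibre_translation_def vec_eq_iff forall_3)
    ultimately show "p \<in> cylinder_surface r"
      unfolding cylinder_surface_def fibre_line_def by blast
  qed (auto simp: cylinder_surface_def fibre_line_def base_circle_eq[OF assms(1)] fibre_translation_def)
  moreover have "fibre_translation \<tau> ` base_figure r
      = {p. (p$1)\<^sup>2 + (p$2)\<^sup>2 \<le> (sinh r)\<^sup>2 \<and> p$3 = \<tau>}"
  proof (intro set_eqI iffI)
    fix p :: "real^3" assume p: "p \<in> {p. (p$1)\<^sup>2 + (p$2)\<^sup>2 \<le> (sinh r)\<^sup>2 \<and> p$3 = \<tau>}"
    then have "vector [p$1, p$2, 0] \<in> base_figure r"
      by (simp add: base_figure_eq[OF assms(1)])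
    moreover have "p = fibre_translation \<tau> (vector [p$1, p$2, 0])"
      using p by (simp add: fibre_translation_def vec_eq_iff forall_3)
    ultimately show "p \<in> fibre_translation \<tau> ` base_figure r"
      by blast
  qed (auto simp: base_figure_eq[OF assms(1)] fibre_translation_def)
  ultimately have S: "cylinder_surface r \<union> base_figure r \<union> fibre_translation \<tau> ` base_figure r
      = {p. (p$1)\<^sup>2 + (p$2)\<^sup>2 = (sinh r)\<^sup>2} \<union>
        {p. (p$1)\<^sup>2 + (p$2)\<^sup>2 \<le> (sinh r)\<^sup>2 \<and> (p$3 = min 0 \<tau> \<or> p$3 = max 0 \<tau>)}"
    unfolding base_figure_eq[OF assms(1)] by (auto simp: min_def max_def)
  have pos: "sinh r > 0" and less: "min 0 \<tau> < max 0 \<tau>"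
    using assms by auto
  show ?thesis
    unfolding model_cylinder_def solid_bounded_by_def S
      inside_capped_cylinder[OF pos less] closure_open_cylinder[OF pos less] ..
qed

theorem lemma4p5:
  fixes r \<Psi> :: real and C :: "(real^3) set"
  assumes "r > 0" and "\<Psi> > 0" and "bounded_fibre_cylinder r \<Psi> C"
  shows "slr_volume C = \<Psi> * pi * (sinh r)\<^sup>2"
proof -
  obtain \<tau> f where "cover_face_distance r \<tau> \<Psi>" and f: "slr_isometry f"
    and C: "C = f ` model_cylinder r \<tau>"
    using assms(3) unfolding bounded_fibre_cylinder_def by blast
  then have \<Psi>: "\<Psi> = \<bar>\<tau>\<bar>"
    using cover_face_distance_imp_abs assms(1) by blast
  with assms(2) have "\<tau> \<noteq> 0" by simp
  note cyl = model_cylinder_eq[OF assms(1) this]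
  \<comment> \<open>Compactness supplies both the finite measure required for applying the isometry
    and the Borel measurability that allows the passage from \<open>lebesgue\<close> to
    \<open>lborel\<close>.\<close>
  have "compact (model_cylinder r \<tau>)"
    unfolding cyl by (intro compact_continuous_image compact_Times linear_continuous_on
        linear_conv_bounded_linear[THEN iffD1] linear_of_cylinder) auto
  then have "slr_volume C = slr_volume (model_cylinder r \<tau>)"
    unfolding C by (intro slr_volume_isometry[OF f] lmeasurable_compact)
  also have "\<dots> = measure lborel (model_cylinder r \<tau>)"
    using \<open>compact _\<close> by (simp add: slr_volume_eq_measure borel_compact measure_completion)
  also have "\<dots> = pi * (sinh r)\<^sup>2 * (max 0 \<tau> - min 0 \<tau>)"
    unfolding cyl using assms(1) by (intro measure_cylinder) auto
  also have "max 0 \<tau> - min 0 \<tau> = \<Psi>"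
    by (simp add: \<Psi>)
  finally show ?thesis by simp
qed

end
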